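(* Let $H$ be a strictly $2$-balanced graph with $m_2(H) > 1$ and let $k \ge 3$ be an integer. (i) If every graph $G$ with $m(G) \le m_2(H)$ satisfies $G \not\xrightarrow{\mathrm{c-ram}} (K_{1,k}, H)$, then there exists a constant $c > 0$ such that for $p = p(n) \le c\, n^{-1/m_2(H)}$ we have $\lim_{n\to\infty}\mathbb{P}\big[G(n,p) \xrightarrow{\mathrm{c-ram}} (K_{1,k}, H)\big] = 0$. (ii) If every graph $G$ with $m(G) < m_2(H)$ satisfies $G \not\xrightarrow{\mathrm{c-ram}} (K_{1,k}, H)$, then for $p = p(n) = o(n^{-1/m_2(H)})$ we have $\lim_{n\to\infty}\mathbb{P}\big[G(n,p) \xrightarrow{\mathrm{c-ram}} (K_{1,k}, H)\big] = 0$.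
   Context: $G(n,p)$ is the random graph on $n$ vertices with each edge present independently with probability $p$. $G \xrightarrow{\mathrm{c-ram}} (H_1,H_2)$ means every edge-colouring of $G$ (with any number of colours) contains either a monochromatic copy of $H_1$ or a rainbow copy of $H_2$ (all edges distinct colours). $m(G) = \max\{e(J)/v(J) : J \subseteq G,\ v(J)\ge 1\}$. For a graph $J$, $d_2(J) = \frac{e(J)-1}{v(J)-2}$ if $e(J)\ge 1$ and $v(J)\ge 3$, $d_2(K_2) = 1/2$, and $d_2(J)=0$ otherwise; $m_2(H) = \max\{d_2(J) : J \subseteq H\}$. $H$ is strictly $2$-balanced if $d_2(J) < d_2(H)$ for every proper subgraph $J \subsetneq H$. $K_{1,k}$ is the star with $k$ edges. *)

theory Defs
  imports
    "HOL-Probability.Probability"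
    "HOL-Library.Ramsey"
    "HOL-Library.Landau_Symbols"
begin

section \<open>Finite simple graphs\<close>

record 'v sgraph =
  verts :: "'v set"
  edges :: "'v set set"

text \<open>The null graph is admitted as a graph.\<close>

definition simple_graph :: "'v sgraph \<Rightarrow> bool" where
  "simple_graph G \<longleftrightarrow> finite (verts G) \<and> edges G \<subseteq> nsets (verts G) 2"

definition subgraph :: "'v sgraph \<Rightarrow> 'v sgraph \<Rightarrow> bool" where
  "subgraph J G \<longleftrightarrow> simple_graph J \<and> verts J \<subseteq> verts G \<and> edges J \<subseteq> edges G"

definition graph_iso :: "'v sgraph \<Rightarrow> 'w sgraph \<Rightarrow> bool" where
  "graph_iso H J \<longleftrightarrow>
    (\<exists>f. bij_betw f (verts H) (verts J) \<and> edges J = (\<lambda>e. f ` e) ` edges H)"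

text \<open>\<open>copy_in J H G\<close>: \<open>J\<close> is a (not necessarily induced) copy of \<open>H\<close> in \<open>G\<close>.\<close>

definition copy_in :: "'v sgraph \<Rightarrow> 'w sgraph \<Rightarrow> 'v sgraph \<Rightarrow> bool" where
  "copy_in J H G \<longleftrightarrow> subgraph J G \<and> graph_iso H J"

definition star :: "nat \<Rightarrow> nat sgraph" where
  "star k = \<lparr>verts = {0..k}, edges = (\<lambda>i. {0, i}) ` {1..k}\<rparr>"

section \<open>Densities\<close>

abbreviation nv :: "'v sgraph \<Rightarrow> nat" where "nv G \<equiv> card (verts G)"

abbreviation ne :: "'v sgraph \<Rightarrow> nat" where "ne G \<equiv> card (edges G)"

text \<open>For the null graph the maximum ranges over the empty set, so the value of
  \<open>max_density\<close> is then unspecified.\<close>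

definition max_density :: "'v sgraph \<Rightarrow> real" where
  "max_density G = Max {real (ne J) / real (nv J) | J. subgraph J G \<and> nv J \<ge> 1}"

text \<open>A simple graph with two vertices and one edge is a \<open>K\<^sub>2\<close>.\<close>

definition d2 :: "'v sgraph \<Rightarrow> real" where
  "d2 J = (if ne J \<ge> 1 \<and> nv J \<ge> 3 then (real (ne J) - 1) / (real (nv J) - 2)
           else if ne J = 1 \<and> nv J = 2 then 1 / 2
           else 0)"

definition m2 :: "'v sgraph \<Rightarrow> real" where
  "m2 H = Max {d2 J | J. subgraph J H}"

definition strictly_2_balanced :: "'v sgraph \<Rightarrow> bool" where
  "strictly_2_balanced H \<longleftrightarrow> (\<forall>J. subgraph J H \<and> J \<noteq> H \<longrightarrow> d2 J < d2 H)"

section \<open>The constrained Ramsey property\<close>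

definition monochromatic :: "('v set \<Rightarrow> 'c) \<Rightarrow> 'v sgraph \<Rightarrow> bool" where
  "monochromatic \<phi> J \<longleftrightarrow> (\<exists>a. \<forall>e\<in>edges J. \<phi> e = a)"

definition rainbow :: "('v set \<Rightarrow> 'c) \<Rightarrow> 'v sgraph \<Rightarrow> bool" where
  "rainbow \<phi> J \<longleftrightarrow> inj_on \<phi> (edges J)"

text \<open>Finite graphs only see finitely many colours, so natural-number colours cover
  colourings with any number of colours. Only the values of \<open>\<phi>\<close> on \<open>edges G\<close> matter.\<close>

definition constrained_ramsey :: "'v sgraph \<Rightarrow> 'w sgraph \<Rightarrow> 'u sgraph \<Rightarrow> bool" where
  "constrained_ramsey G H1 H2 \<longleftrightarrow>
    (\<forall>\<phi> :: 'v set \<Rightarrow> nat.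
       (\<exists>J. copy_in J H1 G \<and> monochromatic \<phi> J) \<or>
       (\<exists>J. copy_in J H2 G \<and> rainbow \<phi> J))"

section \<open>The binomial random graph\<close>

text \<open>The edge indicators are independent Bernoulli variables indexed by the pairs of
  vertices. Note that \<open>bernoulli_pmf\<close> truncates its parameter to the unit interval.\<close>

definition random_graph :: "nat \<Rightarrow> real \<Rightarrow> nat sgraph pmf" where
  "random_graph n p =
    map_pmf (\<lambda>X. \<lparr>verts = {..<n}, edges = {e \<in> nsets {..<n} 2. X e}\<rparr>)
      (Pi_pmf (nsets {..<n} 2) False (\<lambda>_. bernoulli_pmf p))"

end

theory Submission
  imports Defs "HOL-Real_Asymp.Real_Asymp"
begin

text \<open>
  An edge-minimal Ramsey subgraph \<open>E\<close> of the random graph is connected through copies of \<open>H\<close>: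
  were it the union of two edge-disjoint parts such that every copy lies in one of them, good
  colourings of the parts with disjoint palettes would combine. The exponent
  \<open>v(S) - e(S) / m2 H\<close> never increases when a copy sharing an edge with \<open>S\<close> is added, because
  \<open>H\<close> is 2-balanced; so a subgraph of \<open>E\<close> of density above \<open>m2 H\<close> forces the exponent of \<open>E\<close>
  itself to be negative (nonpositive, if the density is only at least \<open>m2 H\<close>).

  Explore \<open>E\<close> copy by copy. Steps sharing exactly one edge keep the exponent, and for
  \<open>p n powr (1 / m2 H)\<close> small they form a subcritical branching process. By strict balancedness
  every other step lowers the exponent by at least \<open>1 / (e(H) - 1)\<close>, so only boundedly many of
  them occur before the exponent drops below 0, and each is chosen among polynomially many (in the
  number of steps) up to a power of \<open>n\<close> that the drop accounts for. Hence the
  expected number of explorations reaching exponent 0 tends to 0 with \<open>p n powr (1 / m2 H)\<close>, and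
  the expected number reaching a negative exponent tends to 0 with \<open>n\<close>.
\<close>

section \<open>Series, finite sums and the edges of the random graph\<close>

lemma summable_poly_geometric:
  "summable (\<lambda>T::nat. real (T + 1) ^ m * (3/4) ^ T)"
proof (rule summable_comparison_test_bigo)
  \<comment> \<open>Any ratio strictly between 3/4 and 1 absorbs the polynomial factor.\<close>
  show "summable (\<lambda>T. norm ((7/8::real) ^ T))" by (simp add: summable_geometric)
  show "(\<lambda>T::nat. real (T + 1) ^ m * (3/4) ^ T) \<in> O(\<lambda>T. (7/8::real) ^ T)"
    by real_asymp
qed

lemma sum_UN_le:
  fixes g :: "'b \<Rightarrow> real"
  assumes "finite I" "\<And>i. i \<in> I \<Longrightarrow> finite (F i)" "\<And>x. g x \<ge> 0"
  shows "sum g (\<Union>i\<in>I. F i) \<le> (\<Sum>i\<in>I. sum g (F i))"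
  using assms(1,2)
proof (induction I rule: finite_induct)
  case (insert i I)
  have "sum g (F i \<union> (\<Union>i\<in>I. F i)) \<le> sum g (F i) + sum g (\<Union>i\<in>I. F i)"
    using insert.prems insert.hyps assms(3) by (simp add: sum_Un sum_nonneg)
  then show ?case using insert by simp
qed simp

lemma finite_subgraphs:
  assumes "simple_graph G"
  shows "finite {J. subgraph J G}"
proof (rule finite_subset)
  show "{J. subgraph J G} \<subseteq> (\<lambda>(V, E). \<lparr>verts = V, edges = E\<rparr>) ` (Pow (verts G) \<times> Pow (edges G))"
  proof
    fix J assume "J \<in> {J. subgraph J G}"
    then show "J \<in> (\<lambda>(V, E). \<lparr>verts = V, edges = E\<rparr>) ` (Pow (verts G) \<times> Pow (edges G))"
      by (cases J) (auto simp: subgraph_def)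
  qed
  have "finite (edges G)" "finite (verts G)"
    using assms by (auto simp: simple_graph_def intro: finite_subset finite_imp_finite_nsets)
  then show "finite ((\<lambda>(V, E). \<lparr>verts = V, edges = E\<rparr>) ` (Pow (verts G) \<times> Pow (edges G)))"
    by auto
qed

text \<open>With the vertex set fixed, a graph is recorded by its edge set alone.\<close>

definition nat_graph :: "nat \<Rightarrow> nat set set \<Rightarrow> nat sgraph" where
  "nat_graph n E = \<lparr>verts = {..<n}, edges = E\<rparr>"

lemma nat_graph_simps [simp]: "verts (nat_graph n E) = {..<n}" "edges (nat_graph n E) = E"
  by (simp_all add: nat_graph_def)

lemma simple_nat_graph: "E \<subseteq> nsets {..<n} 2 \<Longrightarrow> simple_graph (nat_graph n E)"
  by (simp add: simple_graph_def)

text \<open>The event fixes the indicators of the pairs in \<open>S\<close> and leaves the others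
  free, so it is a product event for independent indicators.\<close>

lemma prob_superset_edges:
  assumes "S \<subseteq> nsets {..<n} 2" "0 \<le> p" "p \<le> 1"
  shows "measure_pmf.prob (random_graph n p) {G. S \<subseteq> edges G} = p ^ card S"
proof -
  let ?N = "nsets {..<n} 2"
  have fin: "finite ?N" by (simp add: finite_imp_finite_nsets)
  have "measure_pmf.prob (random_graph n p) {G. S \<subseteq> edges G}
      = measure_pmf.prob (Pi_pmf ?N False (\<lambda>_. bernoulli_pmf p))
          (Pi ?N (\<lambda>e. if e \<in> S then {True} else UNIV))"
    unfolding random_graph_def measure_map_pmf
    by (intro arg_cong2[where f = "measure_pmf.prob"] refl) (use assms(1) in \<open>fastforce simp: Pi_iff\<close>)
  also have "\<dots> = (\<Prod>e\<in>?N. measure_pmf.prob (bernoulli_pmf p) (if e \<in> S then {True} else UNIV))"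
    by (rule measure_Pi_pmf_Pi[OF fin])
  also have "\<dots> = (\<Prod>e\<in>?N. if e \<in> S then p else 1)"
    using assms(2,3) by (intro prod.cong refl) (auto simp: measure_pmf_single)
  also have "\<dots> = p ^ card S"
    using fin assms(1) by (simp add: prod.If_cases Int_absorb1)
  finally show ?thesis .
qed

lemma random_graph_support:
  assumes "G \<in> set_pmf (random_graph n p)"
  shows "G = nat_graph n (edges G)" "edges G \<subseteq> nsets {..<n} 2"
  using assms by (auto simp: random_graph_def nat_graph_def)

section \<open>Strictly 2-balanced graphs\<close>

locale balanced_graph =
  fixes H :: "'v sgraph"
  assumes simple: "simple_graph H"
    and balanced: "strictly_2_balanced H"
    and dense: "m2 H > 1"
begin

text \<open>Copies are counted as labelled embeddings; extensionality keeps their number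
  finite.\<close>

definition emb :: "nat \<Rightarrow> ('v \<Rightarrow> nat) set" where
  "emb n = {f \<in> verts H \<rightarrow>\<^sub>E {..<n}. inj_on f (verts H)}"

definition img :: "('v \<Rightarrow> nat) \<Rightarrow> nat set set" where
  "img f = (\<lambda>h. f ` h) ` edges H"

text \<open>Since \<open>m2 H = (ne H - 1) / (nv H - 2)\<close>, this is \<open>ne H - 1\<close> times the exponent
  \<open>v(S) - e(S) / m2 H\<close> of \<open>n\<close> in the expected number of copies of \<open>S\<close>
  at the threshold.\<close>

definition pot :: "nat set set \<Rightarrow> int" where
  "pot S = (int (ne H) - 1) * int (card (\<Union>S)) - (int (nv H) - 2) * int (card S)"

lemma finite_verts [simp]: "finite (verts H)"
  using simple by (simp add: simple_graph_def)

lemma edges_nsets: "edges H \<subseteq> nsets (verts H) 2"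
  using simple by (simp add: simple_graph_def)

lemma finite_edges [simp]: "finite (edges H)"
  using edges_nsets finite_imp_finite_nsets[OF finite_verts] finite_subset by blast

lemma edgeD:
  assumes "h \<in> edges H"
  shows "h \<subseteq> verts H" "card h = 2" "finite h"
  using assms edges_nsets by (auto simp: nsets_def)

lemma m2_eq_d2: "m2 H = d2 H"
  unfolding m2_def
proof (rule Max_eqI)
  show "finite {d2 J |J. subgraph J H}"
    using finite_subgraphs[OF simple] by auto
  show "d2 H \<in> {d2 J |J. subgraph J H}"
    using simple by (auto simp: subgraph_def)
  fix y assume "y \<in> {d2 J |J. subgraph J H}"
  then show "y \<le> d2 H"
    using balanced unfolding strictly_2_balanced_def by force
qed

text \<open>The other branches of \<open>d2\<close> are at most 1/2, so \<open>m2 H > 1\<close>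
  selects the quotient.\<close>

lemma nv_ge3: "nv H \<ge> 3" and m2_eq: "m2 H = (real (ne H) - 1) / (real (nv H) - 2)"
  using dense unfolding m2_eq_d2 d2_def by (auto split: if_splits)

lemma ne_ge3: "ne H \<ge> 3"
  using dense nv_ge3 unfolding m2_eq by (simp add: field_simps)

text \<open>Strict balancedness with denominators cleared: being between integers, the gap is at
  least 1.\<close>

lemma d2_less:
  assumes "subgraph J H" "J \<noteq> H" "ne J \<ge> 1" "nv J \<ge> 3"
  shows "(int (ne J) - 1) * (int (nv H) - 2) < (int (ne H) - 1) * (int (nv J) - 2)"
proof -
  have "d2 J < d2 H" using assms balanced by (auto simp: strictly_2_balanced_def)
  then have "(real (ne J) - 1) / (real (nv J) - 2) < (real (ne H) - 1) / (real (nv H) - 2)"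
    using assms m2_eq m2_eq_d2 by (simp add: d2_def)
  then have "(real (ne J) - 1) * (real (nv H) - 2) < (real (ne H) - 1) * (real (nv J) - 2)"
    using assms nv_ge3 by (simp add: divide_less_eq field_simps)
  then have "real_of_int ((int (ne J) - 1) * (int (nv H) - 2))
      < real_of_int ((int (ne H) - 1) * (int (nv J) - 2))" by simp
  then show ?thesis by (simp only: of_int_less_iff)
qed

text \<open>Discarding isolated vertices would keep all edges and shrink the denominator of
  \<open>d2\<close>, giving a denser proper subgraph.\<close>

lemma Union_edges: "\<Union>(edges H) = verts H"
proof (rule ccontr)
  assume *: "\<Union>(edges H) \<noteq> verts H"
  define P where "P = \<Union>(edges H)"
  have sub: "P \<subset> verts H" using * edgeD by (auto simp: P_def)
  then have "finite P" using finite_subset[OF psubset_imp_subset finite_verts] by blast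
  define J where "J = H\<lparr>verts := P\<rparr>"
  have J: "verts J = P" "edges J = edges H" by (simp_all add: J_def)
  have eP: "edges H \<subseteq> nsets P 2" using edgeD by (auto simp: P_def nsets_def)
  \<comment> \<open>The quotient branch of \<open>d2\<close> requires three vertices; on fewer, at
    most one edge fits, contrary to \<open>ne_ge3\<close>.\<close>
  have "card P \<ge> 3"
  proof (rule ccontr)
    assume "\<not> card P \<ge> 3"
    have "h = P" if "h \<in> edges H" for h
    proof (rule card_seteq)
      show "h \<subseteq> P" using that by (auto simp: P_def)
      show "card P \<le> card h" using edgeD(2)[OF that] \<open>\<not> card P \<ge> 3\<close> by simp
    qed fact
    then have "edges H \<subseteq> {P}" by auto
    then have "ne H \<le> card {P}" by (intro card_mono) auto
    then show False using ne_ge3 by simp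
  qed
  moreover have "subgraph J H"
    using sub eP \<open>finite P\<close> by (auto simp: subgraph_def simple_graph_def J)
  moreover have "J \<noteq> H" using sub J by auto
  ultimately have "(int (ne H) - 1) * (int (nv H) - 2) < (int (ne H) - 1) * (int (card P) - 2)"
    using d2_less[of J] ne_ge3 J by auto
  moreover have "card P < nv H" using sub by (intro psubset_card_mono) auto
  ultimately show False using ne_ge3 by (simp add: mult_less_cancel_left)
qed

section \<open>Embeddings of \<open>H\<close> and the change of the potential\<close>

lemma embD:
  assumes "f \<in> emb n"
  shows "inj_on f (verts H)" "f \<in> verts H \<rightarrow>\<^sub>E {..<n}" "f ` verts H \<subseteq> {..<n}"
  using assms by (auto simp: emb_def)

lemma finite_emb [simp]: "finite (emb n)"
  unfolding emb_def by (rule finite_subset[of _ "verts H \<rightarrow>\<^sub>E {..<n}"]) (auto intro: finite_PiE)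

lemma finite_img [simp]: "finite (img f)"
  by (simp add: img_def)

lemma Union_img: "\<Union>(img f) = f ` verts H"
  unfolding img_def Union_edges[symmetric] by auto

lemma inj_on_edges:
  assumes "f \<in> emb n"
  shows "inj_on ((`) f) (edges H)"
  using edgeD(1) embD(1)[OF assms] by (meson inj_on_image_eq_iff inj_onI)

lemma card_img: "f \<in> emb n \<Longrightarrow> card (img f) = ne H"
  unfolding img_def by (intro card_image inj_on_edges)

lemma img_nsets:
  assumes "f \<in> emb n"
  shows "img f \<subseteq> nsets {..<n} 2"
proof
  fix a assume "a \<in> img f"
  then obtain h where h: "h \<in> edges H" "a = f ` h" by (auto simp: img_def)
  then have "card a = 2" using embD(1)[OF assms] edgeD[OF h(1)]
    by (metis card_image inj_on_subset)
  moreover have "a \<subseteq> {..<n}" using h edgeD embD(3)[OF assms] by blast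
  ultimately show "a \<in> nsets {..<n} 2" by (auto simp: nsets_def intro: finite_subset)
qed

lemma card_Union_add:
  assumes "finite S" "finite (\<Union>S)" "f \<in> emb n"
  shows "card (\<Union>(S \<union> img f)) + card (f ` verts H \<inter> \<Union>S) = card (\<Union>S) + nv H"
    and "card (S \<union> img f) + card (img f \<inter> S) = card S + ne H"
proof -
  have "card (f ` verts H) = nv H" using embD(1)[OF assms(3)] by (simp add: card_image)
  then show "card (\<Union>(S \<union> img f)) + card (f ` verts H \<inter> \<Union>S) = card (\<Union>S) + nv H"
    using card_Un_Int[of "\<Union>S" "f ` verts H"] assms(2) by (simp add: Union_img Int_commute)
  show "card (S \<union> img f) + card (img f \<inter> S) = card S + ne H"
    using card_Un_Int[of S "img f"] assms(1) card_img[OF assms(3)] by (simp add: Int_commute)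
qed

lemma pot_add:
  assumes "finite S" "finite (\<Union>S)" "f \<in> emb n"
  shows "pot (S \<union> img f) = pot S
    + (int (ne H) - 1) * (int (nv H) - int (card (f ` verts H \<inter> \<Union>S)))
    - (int (nv H) - 2) * (int (ne H) - int (card (img f \<inter> S)))"
proof -
  have *: "int (card (\<Union>(S \<union> img f))) = int (card (\<Union>S)) + int (nv H) - int (card (f ` verts H \<inter> \<Union>S))"
    "int (card (S \<union> img f)) = int (card S) + int (ne H) - int (card (img f \<inter> S))"
    using card_Union_add[OF assms] by linarith+
  show ?thesis unfolding pot_def * by (simp add: algebra_simps)
qed

text \<open>Pulling the overlap with \<open>S\<close> back along \<open>f\<close> gives a proper
  subgraph \<open>J\<close> of \<open>H\<close> with an edge. If \<open>J\<close> has at least three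
  vertices, strict balancedness makes the potential drop; otherwise \<open>J\<close> is a single
  edge and the contributions cancel.\<close>

lemma pot_add_cases:
  assumes fin: "finite S" "finite (\<Union>S)" and f: "f \<in> emb n"
    and a: "a \<in> img f" "a \<in> S" and new: "\<not> img f \<subseteq> S"
  shows "f ` verts H \<inter> \<Union>S = a \<and> img f \<inter> S = {a} \<and> pot (S \<union> img f) = pot S
    \<or> pot (S \<union> img f) < pot S"
proof -
  define J where "J = H\<lparr>verts := {u\<in>verts H. f u \<in> \<Union>S}, edges := {h\<in>edges H. f ` h \<in> S}\<rparr>"
  have vJ: "verts J = {u\<in>verts H. f u \<in> \<Union>S}" and eJ: "edges J = {h\<in>edges H. f ` h \<in> S}"
    by (simp_all add: J_def)
  have sub: "subgraph J H"
  proof -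
    have "h \<in> nsets (verts J) 2" if "h \<in> edges J" for h
      using that edgeD[of h] by (auto simp: vJ eJ nsets_def)
    moreover have "verts J \<subseteq> verts H" "edges J \<subseteq> edges H" by (auto simp: vJ eJ)
    ultimately show ?thesis
      using finite_subset[OF _ finite_verts] by (auto simp: subgraph_def simple_graph_def)
  qed
  have "f ` verts H \<inter> \<Union>S = f ` verts J" by (auto simp: vJ)
  then have cv: "card (f ` verts H \<inter> \<Union>S) = nv J"
    using embD(1)[OF f] by (simp add: card_image inj_on_subset vJ)
  have "img f \<inter> S = (\<lambda>h. f ` h) ` edges J" by (auto simp: eJ img_def)
  moreover have "inj_on ((`) f) (edges J)"
    by (rule inj_on_subset[OF inj_on_edges[OF f]]) (auto simp: eJ)
  ultimately have ce: "card (img f \<inter> S) = ne J" by (simp add: card_image)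
  have "edges J \<noteq> edges H" using new by (auto simp: eJ img_def)
  then have neq: "J \<noteq> H" by auto
  have ne1: "ne J \<ge> 1" using a fin unfolding ce[symmetric]
    by (simp add: Suc_le_eq card_gt_0_iff) blast
  have c2: "card a = 2" using a img_nsets[OF f] by (auto simp: nsets_def)
  have asub: "a \<subseteq> f ` verts H \<inter> \<Union>S" using a Union_img[of f] by auto
  have finI: "finite (f ` verts H \<inter> \<Union>S)" by simp
  have pot: "pot (S \<union> img f) = pot S + (int (ne H) - 1) * (int (nv H) - int (nv J))
    - (int (nv H) - 2) * (int (ne H) - int (ne J))"
    using pot_add[OF fin f] by (simp add: cv ce)
  show ?thesis
  proof (cases "nv J \<ge> 3")
    case True
    have "(int (ne J) - 1) * (int (nv H) - 2) < (int (ne H) - 1) * (int (nv J) - 2)"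
      by (rule d2_less[OF sub neq ne1 True])
    then show ?thesis unfolding pot by (simp add: algebra_simps)
  next
    case False
    have eq: "f ` verts H \<inter> \<Union>S = a"
      using card_seteq[OF finI asub] False c2 cv by simp
    have "img f \<inter> S = {a}"
    proof -
      have "b = a" if "b \<in> img f \<inter> S" for b
      proof -
        have "b \<subseteq> a" using that Union_img[of f] unfolding eq[symmetric] by auto
        moreover have "card b = 2" using that img_nsets[OF f] by (auto simp: nsets_def)
        moreover have "finite a" using c2 by (metis card.infinite zero_neq_numeral)
        ultimately show ?thesis using c2 by (simp add: card_seteq)
      qed
      then show ?thesis using a by blast
    qed
    moreover from this have "ne J = 1" using ce by simp
    moreover have "nv J = 2" using cv eq c2 by simp
    ultimately show ?thesis using eq pot by (simp add: algebra_simps)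
  qed
qed

section \<open>Minimal Ramsey graphs are connected through copies\<close>

text \<open>For \<open>S \<subseteq> E\<close> this lets \<open>E\<close> be cut into
  \<open>S\<close> and \<open>E - S\<close> without destroying a copy of \<open>H\<close>.\<close>

definition closed_in :: "nat \<Rightarrow> nat set set \<Rightarrow> nat set set \<Rightarrow> bool" where
  "closed_in n E S \<longleftrightarrow> (\<forall>f\<in>emb n. img f \<subseteq> E \<longrightarrow> img f \<inter> S \<noteq> {} \<longrightarrow> img f \<subseteq> S)"

lemma obtain_emb:
  assumes "copy_in J H (nat_graph n E)"
  obtains f where "f \<in> emb n" "img f = edges J" "edges J \<subseteq> E"
proof -
  obtain g where g: "bij_betw g (verts H) (verts J)" "edges J = (\<lambda>e. g ` e) ` edges H"
    and sub: "verts J \<subseteq> {..<n}" "edges J \<subseteq> E"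
    using assms by (auto simp: copy_in_def subgraph_def graph_iso_def)
  define f where "f = restrict g (verts H)"
  have fg: "f ` h = g ` h" if "h \<in> edges H" for h
    using edgeD(1)[OF that] by (auto simp: f_def intro!: image_cong)
  have "img f = edges J" unfolding img_def g(2) by (rule image_cong[OF refl fg])
  moreover have "f \<in> emb n"
    using g(1) sub(1) by (auto simp: emb_def f_def bij_betw_def inj_on_def)
  ultimately show ?thesis using sub(2) that by blast
qed

lemma copy_in_mono:
  assumes "copy_in J K (nat_graph n E)" "edges J \<subseteq> E'"
  shows "copy_in J K (nat_graph n E')"
  using assms by (auto simp: copy_in_def subgraph_def)

definition ramsey :: "nat \<Rightarrow> nat \<Rightarrow> nat set set \<Rightarrow> bool" where
  "ramsey n k E \<longleftrightarrow> constrained_ramsey (nat_graph n E) (star k) H"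

lemma star_copy_edges:
  assumes "copy_in J (star k) G" "k \<ge> 2"
  obtains a b where "a \<in> edges J" "b \<in> edges J" "a \<noteq> b"
proof -
  obtain g where g: "bij_betw g {0..k} (verts J)" "edges J = (\<lambda>e. g ` e) ` (\<lambda>i. {0, i}) ` {1..k}"
    using assms(1) by (auto simp: copy_in_def graph_iso_def star_def)
  have "g 1 \<noteq> g 2" "g 0 \<noteq> g 1" "g 0 \<noteq> g 2"
    using bij_betw_imp_inj_on[OF g(1)] assms(2) by (auto dest: inj_onD)
  moreover have "{g 0, g 1} \<in> edges J" "{g 0, g 2} \<in> edges J"
    using assms(2) unfolding g(2) image_image by (auto intro: rev_image_eqI)
  ultimately show ?thesis using that by (metis doubleton_eq_iff)
qed

text \<open>Under an injective colouring no star with two edges is monochromatic, so a copy of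
  \<open>H\<close> must exist. It seeds the exploration.\<close>

lemma ramsey_has_copy:
  assumes "ramsey n k E" "k \<ge> 2" "finite E"
  obtains f where "f \<in> emb n" "img f \<subseteq> E"
proof -
  obtain \<phi> :: "nat set \<Rightarrow> nat" where inj: "inj_on \<phi> E"
    using finite_imp_inj_to_nat_seg[OF assms(3)] by auto
  consider J where "copy_in J (star k) (nat_graph n E)" "monochromatic \<phi> J"
    | J where "copy_in J H (nat_graph n E)"
    using assms(1) unfolding ramsey_def constrained_ramsey_def by metis
  then show ?thesis
  proof cases
    case 1
    obtain a b where ab: "a \<in> edges J" "b \<in> edges J" "a \<noteq> b"
      using star_copy_edges[OF 1(1) assms(2)] by blast
    moreover have "edges J \<subseteq> E" using 1(1) by (auto simp: copy_in_def subgraph_def)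
    ultimately show ?thesis using 1(2) inj unfolding monochromatic_def
      by (metis inj_onD subset_iff)
  next
    case 2
    show ?thesis by (rule obtain_emb[OF 2]) (use that in blast)
  qed
qed

text \<open>Good colourings of the two parts are combined using disjoint palettes.\<close>

lemma ramsey_split:
  assumes cl: "closed_in n E S" and "S \<subseteq> E" "k \<ge> 2" "\<not> ramsey n k S" "\<not> ramsey n k (E - S)"
  shows "\<not> ramsey n k E"
proof -
  obtain \<phi>1 :: "nat set \<Rightarrow> nat" where \<phi>1:
    "\<And>J. copy_in J (star k) (nat_graph n S) \<Longrightarrow> \<not> monochromatic \<phi>1 J"
    "\<And>J. copy_in J H (nat_graph n S) \<Longrightarrow> \<not> rainbow \<phi>1 J"
    using assms(4) by (auto simp: ramsey_def constrained_ramsey_def)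
  obtain \<phi>2 :: "nat set \<Rightarrow> nat" where \<phi>2:
    "\<And>J. copy_in J (star k) (nat_graph n (E - S)) \<Longrightarrow> \<not> monochromatic \<phi>2 J"
    "\<And>J. copy_in J H (nat_graph n (E - S)) \<Longrightarrow> \<not> rainbow \<phi>2 J"
    using assms(5) by (auto simp: ramsey_def constrained_ramsey_def)
  define \<phi> where "\<phi> = (\<lambda>e. if e \<in> S then 2 * \<phi>1 e else 2 * \<phi>2 e + 1)"
  have even: "even (\<phi> e) \<longleftrightarrow> e \<in> S" for e by (simp add: \<phi>_def)
  have "\<not> monochromatic \<phi> J" if J: "copy_in J (star k) (nat_graph n E)" for J
  proof
    assume "monochromatic \<phi> J"
    then obtain c where c: "\<And>e. e \<in> edges J \<Longrightarrow> \<phi> e = c" by (auto simp: monochromatic_def)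
    have "edges J \<subseteq> E" using J by (auto simp: copy_in_def subgraph_def)
    show False
    \<comment> \<open>The parity of the common colour puts the whole star into one part.\<close>
    proof (cases "even c")
      case True
      then have S: "edges J \<subseteq> S" using c even by blast
      then have "\<phi>1 e = c div 2" if "e \<in> edges J" for e
        using c[OF that] that unfolding \<phi>_def by auto
      then have "monochromatic \<phi>1 J" by (auto simp: monochromatic_def)
      then show False using \<phi>1(1) copy_in_mono[OF J S] by blast
    next
      case False
      then have S: "edges J \<subseteq> E - S" using c even \<open>edges J \<subseteq> E\<close> by blast
      then have "\<phi>2 e = c div 2" if "e \<in> edges J" for e
        using c[OF that] that unfolding \<phi>_def by auto
      then have "monochromatic \<phi>2 J" by (auto simp: monochromatic_def)
      then show False using \<phi>2(1) copy_in_mono[OF J S] by blast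
    qed
  qed
  moreover have "\<not> rainbow \<phi> J" if J: "copy_in J H (nat_graph n E)" for J
  proof
    assume r: "rainbow \<phi> J"
    obtain f where f: "f \<in> emb n" "img f = edges J" "edges J \<subseteq> E" using obtain_emb[OF J] .
    show False
    proof (cases "edges J \<inter> S = {}")
      case True
      then have S: "edges J \<subseteq> E - S" using f by auto
      have "rainbow \<phi>2 J"
        unfolding rainbow_def
      proof (rule inj_onI)
        fix x y assume "x \<in> edges J" "y \<in> edges J" "\<phi>2 x = \<phi>2 y"
        moreover from this have "\<phi> x = \<phi> y" using S by (auto simp: \<phi>_def)
        ultimately show "x = y" using r by (auto simp: rainbow_def dest: inj_onD)
      qed
      then show False using \<phi>2(2) copy_in_mono[OF J S] by blast
    next
      case False
      \<comment> \<open>Closedness: a copy of \<open>H\<close> meeting \<open>S\<close> cannot leave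
        it.\<close>
      then have S: "edges J \<subseteq> S" using f cl by (metis closed_in_def)
      have "rainbow \<phi>1 J"
        unfolding rainbow_def
      proof (rule inj_onI)
        fix x y assume "x \<in> edges J" "y \<in> edges J" "\<phi>1 x = \<phi>1 y"
        moreover from this have "\<phi> x = \<phi> y" using S by (auto simp: \<phi>_def)
        ultimately show "x = y" using r by (auto simp: rainbow_def dest: inj_onD)
      qed
      then show False using \<phi>1(2) copy_in_mono[OF J S] by blast
    qed
  qed
  ultimately show ?thesis unfolding ramsey_def constrained_ramsey_def by blast
qed

text \<open>Take \<open>E\<close> of least cardinality. A nonempty proper closed part would leave
  two smaller, hence non-Ramsey, parts, against \<open>ramsey_split\<close>.\<close>

lemma minimal_ramsey:
  assumes "ramsey n k E0" "finite E0" "k \<ge> 2"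
  obtains E where "E \<subseteq> E0" "ramsey n k E"
    "\<And>S. S \<subseteq> E \<Longrightarrow> S \<noteq> {} \<Longrightarrow> closed_in n E S \<Longrightarrow> S = E"
proof -
  obtain E where E: "E \<subseteq> E0" "ramsey n k E"
    and min: "\<And>E'. E' \<subseteq> E0 \<Longrightarrow> ramsey n k E' \<Longrightarrow> card E \<le> card E'"
    using ex_has_least_nat[of "\<lambda>E. E \<subseteq> E0 \<and> ramsey n k E" E0 card] assms(1) by blast
  have fin: "finite E" using E(1) assms(2) finite_subset by blast
  have "S = E" if S: "S \<subseteq> E" "S \<noteq> {}" "closed_in n E S" for S
  proof (rule ccontr)
    assume "S \<noteq> E"
    then have "S \<subset> E" "E - S \<subset> E" using S by auto
    then have "card S < card E" "card (E - S) < card E" using fin psubset_card_mono by auto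
    then have "\<not> ramsey n k S" "\<not> ramsey n k (E - S)"
      using min[of S] min[of "E - S"] S(1) E(1) by fastforce+
    then show False using ramsey_split[OF S(3,1) assms(3)] E(2) by blast
  qed
  then show ?thesis using E that by blast
qed

text \<open>Saturation: as long as a copy in \<open>E\<close> meets \<open>S\<close> and sticks out,
  add it; by \<open>pot_add_cases\<close> the potential never rises.\<close>

lemma closed_superset_pot_le:
  assumes "S \<subseteq> E" "S \<noteq> {}" "E \<subseteq> nsets {..<n} 2"
  shows "\<exists>S'. S \<subseteq> S' \<and> S' \<subseteq> E \<and> closed_in n E S' \<and> pot S' \<le> pot S"
  using assms(1,2)
proof (induction "card (E - S)" arbitrary: S rule: less_induct)
  case less
  have finE: "finite E" using assms(3) finite_subset finite_imp_finite_nsets by blast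
  then have finS: "finite S" using less.prems finite_subset by blast
  have "\<Union>S \<subseteq> {..<n}" using less.prems assms(3) by (auto simp: nsets_def)
  then have finU: "finite (\<Union>S)" using finite_subset by blast
  show ?case
  proof (cases "closed_in n E S")
    case False
    then obtain f a where f: "f \<in> emb n" "img f \<subseteq> E" "a \<in> img f" "a \<in> S" "\<not> img f \<subseteq> S"
      by (auto simp: closed_in_def)
    have le: "pot (S \<union> img f) \<le> pot S"
      using pot_add_cases[OF finS finU f(1,3,4,5)] by auto
    have "E - (S \<union> img f) \<subset> E - S" using f by auto
    then have "card (E - (S \<union> img f)) < card (E - S)" using finE by (intro psubset_card_mono) auto
    from less.hyps[OF this] show ?thesis using f(2) less.prems le
      by (smt (verit, best) Un_empty Un_subset_iff)
  qed (use less.prems in blast)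
qed

lemma pot_le_subgraph:
  assumes "E \<subseteq> nsets {..<n} 2"
    and conn: "\<And>S. S \<subseteq> E \<Longrightarrow> S \<noteq> {} \<Longrightarrow> closed_in n E S \<Longrightarrow> S = E"
    and "S \<subseteq> E" "S \<noteq> {}"
  shows "pot E \<le> pot S"
proof -
  obtain S' where S': "S \<subseteq> S'" "S' \<subseteq> E" "closed_in n E S'" "pot S' \<le> pot S"
    using closed_superset_pot_le[OF assms(3,4,1)] by blast
  then have "S' = E" using conn[of S'] assms(4) by blast
  then show ?thesis using S' by simp
qed

section \<open>From dense subgraphs to the potential\<close>

lemma max_density_attained:
  assumes "n \<ge> 1"
  obtains J where "subgraph J (nat_graph n E)" "nv J \<ge> 1"
    "max_density (nat_graph n E) = real (ne J) / real (nv J)"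
proof -
  let ?X = "{real (ne J) / real (nv J) | J. subgraph J (nat_graph n E) \<and> nv J \<ge> 1}"
  \<comment> \<open>\<open>E\<close> may contain sets that are not pairs of vertices; subgraphs
    avoid them, so finiteness is read off the simple part.\<close>
  have "subgraph J (nat_graph n E) \<Longrightarrow> subgraph J (nat_graph n (E \<inter> nsets {..<n} 2))" for J
    using nsets_mono[of "verts J" "{..<n}" 2] by (auto simp: subgraph_def simple_graph_def)
  then have "{J. subgraph J (nat_graph n E)} \<subseteq> {J. subgraph J (nat_graph n (E \<inter> nsets {..<n} 2))}"
    by auto
  moreover have "simple_graph (nat_graph n (E \<inter> nsets {..<n} 2))"
    by (auto simp: simple_graph_def)
  ultimately have "finite {J. subgraph J (nat_graph n E)}"
    using finite_subgraphs finite_subset by blast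
  then have "finite ?X" by auto
  moreover have "subgraph (nat_graph n {}) (nat_graph n E)"
    by (auto simp: subgraph_def simple_graph_def)
  then have "?X \<noteq> {}" using assms by (auto intro!: exI[of _ "nat_graph n {}"])
  ultimately have "max_density (nat_graph n E) \<in> ?X" unfolding max_density_def by (rule Max_in)
  then show ?thesis using that by blast
qed

text \<open>Cleared of denominators, the density bound on a densest \<open>J\<close> says that its
  potential is nonpositive (negative); connectedness carries this over to \<open>E\<close>.\<close>

lemma dense_subgraph_pot:
  assumes "n \<ge> 1" "E \<subseteq> nsets {..<n} 2"
    and conn: "\<And>S. S \<subseteq> E \<Longrightarrow> S \<noteq> {} \<Longrightarrow> closed_in n E S \<Longrightarrow> S = E"
  shows "max_density (nat_graph n E) \<ge> m2 H \<Longrightarrow> pot E \<le> 0"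
    and "max_density (nat_graph n E) > m2 H \<Longrightarrow> pot E < 0"
proof -
  obtain J where J: "subgraph J (nat_graph n E)" "nv J \<ge> 1"
    "max_density (nat_graph n E) = real (ne J) / real (nv J)"
    using max_density_attained[OF assms(1)] .
  have sub: "edges J \<subseteq> E" "\<Union>(edges J) \<subseteq> verts J" "finite (verts J)"
    using J(1) by (auto simp: subgraph_def simple_graph_def nsets_def)
  have le: "pot E \<le> (int (ne H) - 1) * int (nv J) - (int (nv H) - 2) * int (ne J)" if "ne J > 0"
  proof -
    have "pot E \<le> pot (edges J)"
      using pot_le_subgraph[OF assms(2) conn sub(1)] that by fastforce
    \<comment> \<open>Isolated vertices of \<open>J\<close> count in \<open>nv J\<close> but not in
      the potential.\<close>
    also have "\<dots> \<le> (int (ne H) - 1) * int (nv J) - (int (nv H) - 2) * int (ne J)"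
      unfolding pot_def using card_mono[OF sub(3,2)] ne_ge3 by (simp add: mult_left_mono)
    finally show ?thesis .
  qed
  have v: "real (nv J) > 0" "real (nv H) - 2 > 0" "real (ne H) - 1 > 0"
    using J(2) nv_ge3 ne_ge3 by simp_all
  have pos: "ne J > 0" if "max_density (nat_graph n E) \<ge> m2 H"
    using that dense J(3) by (cases "ne J = 0") auto
  {
    assume *: "max_density (nat_graph n E) \<ge> m2 H"
    then have "(real (ne H) - 1) * real (nv J) \<le> (real (nv H) - 2) * real (ne J)"
      using v unfolding J(3) m2_eq by (simp add: field_simps)
    then have "real_of_int ((int (ne H) - 1) * int (nv J)) \<le> real_of_int ((int (nv H) - 2) * int (ne J))"
      by simp
    then show "pot E \<le> 0" using le[OF pos[OF *]] by (simp only: of_int_le_iff)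
  next
    assume *: "max_density (nat_graph n E) > m2 H"
    then have "(real (ne H) - 1) * real (nv J) < (real (nv H) - 2) * real (ne J)"
      using v unfolding J(3) m2_eq by (simp add: field_simps)
    then have "real_of_int ((int (ne H) - 1) * int (nv J)) < real_of_int ((int (nv H) - 2) * int (ne J))"
      by simp
    then show "pot E < 0" using le[OF pos[OF less_imp_le[OF *]]] by (simp only: of_int_less_iff)
  }
qed

section \<open>Exploration by copies\<close>

text \<open>A state consists of the active and of the dead edges found so far. A step takes an active
  edge determined by the state and either declares it dead or adds a copy of \<open>H\<close> meeting the old
  edges in this edge only; degenerate steps add a copy that lowers the potential.\<close>

definition pick :: "nat set set \<Rightarrow> nat set" where
  "pick A = (SOME a. a \<in> A)"

definition cover :: "nat set set \<times> nat set set \<Rightarrow> nat set set" where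
  "cover s = fst s \<union> snd s"

definition kill :: "nat set set \<times> nat set set \<Rightarrow> nat set set \<times> nat set set" where
  "kill s = (fst s - {pick (fst s)}, insert (pick (fst s)) (snd s))"

text \<open>Subtracting the dead edges keeps the active and dead sets disjoint.\<close>

definition add :: "nat set set \<times> nat set set \<Rightarrow> ('v \<Rightarrow> nat) \<Rightarrow> nat set set \<times> nat set set" where
  "add s f = (fst s \<union> (img f - snd s), snd s)"

definition reg :: "nat \<Rightarrow> nat set set \<times> nat set set \<Rightarrow> ('v \<Rightarrow> nat) set" where
  "reg n s = {f \<in> emb n. img f \<inter> cover s = {pick (fst s)} \<and>
     f ` verts H \<inter> \<Union>(cover s) = pick (fst s) \<and> pot (cover s \<union> img f) = pot (cover s)}"

definition deg :: "nat \<Rightarrow> nat set set \<times> nat set set \<Rightarrow> ('v \<Rightarrow> nat) set" where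
  "deg n s = {f \<in> emb n. pot (cover s \<union> img f) < pot (cover s)}"

text \<open>The steps that preserve the potential are grouped because only their joint weight
  contracts.\<close>

definition keep :: "nat \<Rightarrow> nat set set \<times> nat set set \<Rightarrow> (nat set set \<times> nat set set) set" where
  "keep n s = (if fst s = {} then {} else insert (kill s) (add s ` reg n s))"

text \<open>\<open>reach n T d\<close>: the states after \<open>T\<close> steps, of which \<open>d\<close> are degenerate.\<close>

fun reach :: "nat \<Rightarrow> nat \<Rightarrow> nat \<Rightarrow> (nat set set \<times> nat set set) set" where
  "reach n 0 0 = (\<lambda>f. (img f, {})) ` emb n"
| "reach n 0 (Suc d) = {}"
| "reach n (Suc T) 0 = (\<Union>s\<in>reach n T 0. keep n s)"
| "reach n (Suc T) (Suc d) =
    (\<Union>s\<in>reach n T (Suc d). keep n s) \<union> (\<Union>s\<in>reach n T d. add s ` deg n s)"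

lemma pick_in: "A \<noteq> {} \<Longrightarrow> pick A \<in> A"
  unfolding pick_def by (simp add: some_in_eq)

lemma cover_kill [simp]: "fst s \<noteq> {} \<Longrightarrow> cover (kill s) = cover s"
  using pick_in[of "fst s"] by (auto simp: cover_def kill_def)

lemma cover_add [simp]: "cover (add s f) = cover s \<union> img f"
  by (auto simp: cover_def add_def)

lemma reach_keep: "s \<in> reach n T d \<Longrightarrow> s' \<in> keep n s \<Longrightarrow> s' \<in> reach n (Suc T) d"
  by (cases d) auto

lemma reach_cases [consumes 1, case_names init keep deg]:
  assumes "s \<in> reach n T d"
  obtains f where "T = 0" "d = 0" "f \<in> emb n" "s = (img f, {})"
  | T' s' where "T = Suc T'" "s' \<in> reach n T' d" "s \<in> keep n s'"
  | T' d' s' f where "T = Suc T'" "d = Suc d'" "s' \<in> reach n T' d'" "f \<in> deg n s'" "s = add s' f"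
  using assms by (cases T; cases d) auto

lemma finite_nsets2 [simp]: "finite (nsets {..<n::nat} 2)"
  by (simp add: finite_imp_finite_nsets)

section \<open>Invariants and termination of the exploration\<close>

definition pot0 :: int where
  "pot0 = (int (ne H) - 1) * int (nv H) - (int (nv H) - 2) * int (ne H)"

text \<open>Degenerate steps lower the integer potential by at least 1 and no step raises it; the
  vertex bound later keeps the choices per degenerate step polynomial in \<open>T\<close>.\<close>

definition valid :: "nat \<Rightarrow> nat \<Rightarrow> nat \<Rightarrow> nat set set \<times> nat set set \<Rightarrow> bool" where
  "valid n T d s \<longleftrightarrow> fst s \<inter> snd s = {} \<and> cover s \<subseteq> nsets {..<n} 2 \<and>
     card (\<Union>(cover s)) \<le> nv H * Suc T \<and> pot (cover s) + int d \<le> pot0"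

lemma pot_img: "f \<in> emb n \<Longrightarrow> pot (img f) = pot0"
  using embD(1) by (simp add: pot_def pot0_def Union_img card_image card_img)

lemma card_Union_add_le:
  assumes "f \<in> emb n"
  shows "card (\<Union>(S \<union> img f)) \<le> card (\<Union>S) + nv H"
proof -
  have "card (\<Union>S \<union> f ` verts H) \<le> card (\<Union>S) + card (f ` verts H)" by (rule card_Un_le)
  also have "card (f ` verts H) \<le> nv H" by (simp add: card_image_le)
  finally show ?thesis by (simp add: Union_img)
qed

lemma valid_add:
  assumes "valid n T d s" "f \<in> emb n" "pot (cover s \<union> img f) + int d' \<le> pot (cover s) + int d"
  shows "valid n (Suc T) d' (add s f)"
  using assms(1,3) card_Union_add_le[OF assms(2), of "cover s"] img_nsets[OF assms(2)]
  unfolding valid_def cover_add by (auto simp: add_def)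

lemma reach_valid: "s \<in> reach n T d \<Longrightarrow> valid n T d s"
proof (induction T arbitrary: s d)
  case 0
  then show ?case
  proof (cases rule: reach_cases)
    case (init f)
    then show ?thesis using img_nsets[of f n] pot_img[of f n] embD(1)[of f n]
      by (simp add: valid_def cover_def Union_img card_image)
  qed auto
next
  case (Suc T)
  from Suc.prems show ?case
  proof (cases rule: reach_cases)
    case (keep T' s')
    then have v: "valid n T d s'" using Suc.IH by auto
    have ne: "fst s' \<noteq> {}" using keep by (auto simp: keep_def split: if_splits)
    consider "s = kill s'" | f where "f \<in> reg n s'" "s = add s' f"
      using keep ne by (auto simp: keep_def)
    then show ?thesis
    proof cases
      case 1
      then show ?thesis using v cover_kill[OF ne] unfolding valid_def by (auto simp: kill_def)
    next
      case 2
      then show ?thesis using v by (auto simp: reg_def intro!: valid_add[OF v])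
    qed
  next
    case (deg T' d' s' f)
    then have "valid n T d' s'" using Suc.IH by auto
    then show ?thesis unfolding deg(5) using deg by (intro valid_add) (auto simp: deg_def)
  qed auto
qed

lemma valid_finite:
  assumes "valid n T d s"
  shows "finite (fst s)" "finite (snd s)" "finite (cover s)" "finite (\<Union>(cover s))"
proof -
  have c: "cover s \<subseteq> nsets {..<n} 2" using assms by (simp add: valid_def)
  show "finite (cover s)" using c finite_nsets2 finite_subset by blast
  then show "finite (fst s)" "finite (snd s)" by (auto simp: cover_def)
  have "\<Union>(cover s) \<subseteq> {..<n}" using c by (auto simp: nsets_def)
  then show "finite (\<Union>(cover s))" using finite_subset by blast
qed

lemma finite_reach [simp]: "finite (reach n T d)"
proof (rule finite_subset)
  show "reach n T d \<subseteq> Pow (nsets {..<n} 2) \<times> Pow (nsets {..<n} 2)"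
    using reach_valid by (fastforce simp: valid_def cover_def)
qed simp

text \<open>While the potential is nonnegative, at most \<open>pot0\<close> degenerate steps have
  occurred; one more is allowed for the step that crosses zero.\<close>

definition max_deg :: nat where "max_deg = Suc (nat pot0)"

text \<open>The exploration follows \<open>E\<close>: if a copy in \<open>E\<close> through the
  picked edge sticks out of the cover, add it, otherwise declare the edge dead. The last premise,
  that copies through dead edges are covered, persists, so once no edge is active the cover is
  closed and equals \<open>E\<close>.\<close>

lemma exploration_stops:
  assumes E: "E \<subseteq> nsets {..<n} 2"
    and conn: "\<And>S. S \<subseteq> E \<Longrightarrow> S \<noteq> {} \<Longrightarrow> closed_in n E S \<Longrightarrow> S = E"
    and Q: "Q E" "\<And>S. pot S < 0 \<Longrightarrow> Q S"
    and "s \<in> reach n T d" "cover s \<subseteq> E" "cover s \<noteq> {}" "d \<le> max_deg"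
    and "\<And>f. f \<in> emb n \<Longrightarrow> img f \<subseteq> E \<Longrightarrow> img f \<inter> snd s \<noteq> {} \<Longrightarrow> img f \<subseteq> cover s"
  shows "\<exists>T'\<le>T + 2 * card (E - cover s) + card (fst s).
    \<exists>d'\<le>max_deg. \<exists>s'\<in>reach n T' d'. cover s' \<subseteq> E \<and> Q (cover s')"
  using assms(5-)
\<comment> \<open>An uncovered edge weighs 2, an active one 1, a dead one 0; every step lowers the
  total, which therefore bounds the number of steps.\<close>
proof (induction "2 * card (E - cover s) + card (fst s)" arbitrary: s T d rule: less_induct)
  case less
  have v: "valid n T d s" using less.prems(1) by (rule reach_valid)
  note fin = valid_finite[OF v]
  have finE: "finite E" using E finite_nsets2 finite_subset by blast
  show ?case
  proof (cases "Q (cover s)")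
    case True
    have "T \<le> T + 2 * card (E - cover s) + card (fst s)" by simp
    with True show ?thesis using less.prems(1,2,4) by blast
  next
    case False
    then have "pot (cover s) \<ge> 0" using Q(2) by force
    moreover have "pot (cover s) + int d \<le> pot0" using v by (simp add: valid_def)
    ultimately have d: "Suc d \<le> max_deg" by (simp add: max_deg_def le_nat_iff)
    have ne: "fst s \<noteq> {}"
    proof
      assume "fst s = {}"
      then have "closed_in n E (cover s)"
        using less.prems(5) by (auto simp: closed_in_def cover_def)
      then show False using conn[OF less.prems(2,3)] False Q(1) by simp
    qed
    define a where "a = pick (fst s)"
    have a: "a \<in> fst s" using pick_in[OF ne] by (simp add: a_def)
    show ?thesis
    proof (cases "\<forall>f\<in>emb n. img f \<subseteq> E \<longrightarrow> a \<in> img f \<longrightarrow> img f \<subseteq> cover s")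
      case True
      have lt: "card (fst (kill s)) < card (fst s)"
        using card_Diff1_less[OF fin(1) a] by (simp only: kill_def a_def fst_conv)
      have "kill s \<in> reach n (Suc T) d"
        using reach_keep[OF less.prems(1)] ne by (auto simp: keep_def)
      moreover have "img f \<subseteq> cover (kill s)"
        if "f \<in> emb n" "img f \<subseteq> E" "img f \<inter> snd (kill s) \<noteq> {}" for f
      proof -
        have "a \<in> img f \<or> img f \<inter> snd s \<noteq> {}" using that(3) by (auto simp: kill_def a_def)
        then have "img f \<subseteq> cover s" using that(1,2) True less.prems(5) by blast
        then show ?thesis using ne by simp
      qed
      ultimately have "\<exists>T'\<le>Suc T + 2 * card (E - cover (kill s)) + card (fst (kill s)).
          \<exists>d'\<le>max_deg. \<exists>s'\<in>reach n T' d'. cover s' \<subseteq> E \<and> Q (cover s')"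
        using less.hyps[of "kill s" "Suc T" d] less.prems lt ne by auto
      moreover have "Suc T + 2 * card (E - cover (kill s)) + card (fst (kill s))
          \<le> T + 2 * card (E - cover s) + card (fst s)" using lt ne by simp
      ultimately show ?thesis by (meson le_trans)
    next
      case False
      then obtain f where f: "f \<in> emb n" "img f \<subseteq> E" "a \<in> img f" "\<not> img f \<subseteq> cover s" by blast
      have aS: "a \<in> cover s" using a by (simp add: cover_def)
      obtain d' where d': "d' \<le> max_deg" "add s f \<in> reach n (Suc T) d'"
      proof (cases "f \<in> deg n s")
        case True
        then have "add s f \<in> reach n (Suc T) (Suc d)" using less.prems(1) by auto
        then show ?thesis using d that by blast
      next
        case False
        then have "f \<in> reg n s"
          using pot_add_cases[OF fin(3,4) f(1,3) aS f(4)] f(1) by (auto simp: reg_def deg_def a_def)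
        then have "add s f \<in> reach n (Suc T) d"
          using reach_keep[OF less.prems(1)] ne by (auto simp: keep_def)
        then show ?thesis using less.prems(4) that by blast
      qed
      define m where "m = card (img f - cover s)"
      have "m > 0" using f(4) by (auto simp: m_def card_gt_0_iff)
      have "fst (add s f) = fst s \<union> (img f - cover s)" by (auto simp: add_def cover_def)
      moreover have "card (fst s \<union> (img f - cover s)) = card (fst s) + m"
        unfolding m_def using fin by (intro card_Un_disjoint) (auto simp: cover_def)
      ultimately have c1: "card (fst (add s f)) = card (fst s) + m" by simp
      have "E - cover s = (E - cover (add s f)) \<union> (img f - cover s)" using f by auto
      then have "card (E - cover s) = card ((E - cover (add s f)) \<union> (img f - cover s))" by simp
      also have "\<dots> = card (E - cover (add s f)) + m"
        unfolding m_def using finE by (intro card_Un_disjoint) auto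
      finally have c2: "card (E - cover s) = card (E - cover (add s f)) + m" .
      have "img g \<subseteq> cover (add s f)"
        if "g \<in> emb n" "img g \<subseteq> E" "img g \<inter> snd (add s f) \<noteq> {}" for g
      proof -
        have "snd (add s f) = snd s" by (simp add: add_def)
        then have "img g \<subseteq> cover s" using that less.prems(5)[of g] by simp
        then show ?thesis by auto
      qed
      then have "\<exists>T'\<le>Suc T + 2 * card (E - cover (add s f)) + card (fst (add s f)).
          \<exists>d'\<le>max_deg. \<exists>s'\<in>reach n T' d'. cover s' \<subseteq> E \<and> Q (cover s')"
        using less.hyps[of "add s f" "Suc T" d'] d' less.prems(2,3) f(2) c1 c2 \<open>m > 0\<close>
        by (simp add: add.assoc)
      moreover have "Suc T + 2 * card (E - cover (add s f)) + card (fst (add s f))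
          \<le> T + 2 * card (E - cover s) + card (fst s)" using c1 c2 \<open>m > 0\<close> by simp
      ultimately show ?thesis by (meson le_trans)
    qed
  qed
qed

text \<open>\<open>Q\<close> will be a potential of at most 0 or at most -1, so one argument serves
  both thresholds. The bound on \<open>T\<close> keeps the later union bound finite.\<close>

lemma ramsey_witness:
  assumes "ramsey n k E0" "E0 \<subseteq> nsets {..<n} 2" "k \<ge> 2"
    and Q: "\<And>S. pot S < 0 \<Longrightarrow> Q S"
    and dens: "\<And>E. E \<subseteq> nsets {..<n} 2 \<Longrightarrow> ramsey n k E \<Longrightarrow>
      (\<And>S. S \<subseteq> E \<Longrightarrow> S \<noteq> {} \<Longrightarrow> closed_in n E S \<Longrightarrow> S = E) \<Longrightarrow> Q E"
  obtains T d s where "T \<le> 2 * card (nsets {..<n} 2)" "d \<le> max_deg" "s \<in> reach n T d"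
    "cover s \<subseteq> E0" "Q (cover s)"
proof -
  have fin0: "finite E0" using assms(2) finite_nsets2 finite_subset by blast
  obtain E where E: "E \<subseteq> E0" "ramsey n k E"
    and conn: "\<And>S. S \<subseteq> E \<Longrightarrow> S \<noteq> {} \<Longrightarrow> closed_in n E S \<Longrightarrow> S = E"
    using minimal_ramsey[OF assms(1) fin0 assms(3)] by blast
  have En: "E \<subseteq> nsets {..<n} 2" and finE: "finite E"
    using E(1) assms(2) fin0 finite_subset by auto
  obtain f where f: "f \<in> emb n" "img f \<subseteq> E"
    using ramsey_has_copy[OF E(2) assms(3) finE] .
  let ?s = "(img f, {} :: nat set set)"
  have "Q E" using dens[OF En E(2) conn] .
  moreover have "?s \<in> reach n 0 0" using f by auto
  moreover have c: "cover ?s = img f" by (simp add: cover_def)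
  moreover have "img f \<noteq> {}" using card_img[OF f(1)] ne_ge3 by auto
  ultimately obtain T d s where s: "T \<le> 0 + 2 * card (E - cover ?s) + card (fst ?s)"
    "d \<le> max_deg" "s \<in> reach n T d" "cover s \<subseteq> E" "Q (cover s)"
    using exploration_stops[OF En conn, of Q ?s 0 0] Q f(2) by fastforce
  have "card (E - img f) + card (img f) = card E"
    using f(2) finE by (simp add: card_Diff_subset card_mono)
  then have "T \<le> 2 * card E" using s(1) c by simp
  also have "card E \<le> card (nsets {..<n} 2)" using En by (intro card_mono) auto
  finally show ?thesis using that s E(1) by auto
qed

section \<open>Weighted counting of explorations\<close>

text \<open>For \<open>\<epsilon> = p n powr (1 / m2 H)\<close> the first two factors are \<open>p ^ e(S)\<close> times \<open>n\<close> to minus the exponent of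
  \<open>S\<close>; the last one makes declaring an edge dead halve the weight.\<close>

definition wt :: "nat \<Rightarrow> real \<Rightarrow> nat set set \<times> nat set set \<Rightarrow> real" where
  "wt n \<epsilon> s = \<epsilon> ^ card (cover s) * (1 / real n) ^ card (\<Union>(cover s)) * 2 ^ card (fst s)"

lemma wt_nonneg: "\<epsilon> \<ge> 0 \<Longrightarrow> wt n \<epsilon> s \<ge> 0"
  by (simp add: wt_def)

text \<open>Give vertices in \<open>Q\<close> weight 1 and all others \<open>1 / n\<close>; the
  total vertex weight is at most \<open>card Q + 1\<close>.\<close>

lemma sum_emb_le:
  assumes "finite Q" "n \<ge> 1"
  shows "(\<Sum>f\<in>emb n. (1 / real n) ^ (nv H - card (f ` verts H \<inter> Q))) \<le> (real (card Q) + 1) ^ nv H"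
proof -
  define w where "w = (\<lambda>x. if x \<in> Q then 1 else 1 / real n)"
  have w: "w x \<ge> 0" for x by (simp add: w_def)
  have "(1 / real n) ^ (nv H - card (f ` verts H \<inter> Q)) = (\<Prod>u\<in>verts H. w (f u))"
    if f: "f \<in> emb n" for f
  proof -
    have "f ` verts H \<inter> Q = f ` (verts H \<inter> {u. f u \<in> Q})" by auto
    then have "card (f ` verts H \<inter> Q) = card (verts H \<inter> {u. f u \<in> Q})"
      using embD(1)[OF f] by (simp add: card_image inj_on_subset)
    moreover have "card (verts H - {u. f u \<in> Q}) = nv H - card (verts H \<inter> {u. f u \<in> Q})"
      by (simp add: card_Diff_subset_Int)
    ultimately show ?thesis unfolding w_def by (simp add: prod.If_cases Diff_eq)
  qed
  then have "(\<Sum>f\<in>emb n. (1 / real n) ^ (nv H - card (f ` verts H \<inter> Q)))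
      = (\<Sum>f\<in>emb n. \<Prod>u\<in>verts H. w (f u))" by simp
  \<comment> \<open>Dropping injectivity makes the sum factor over the vertices of
    \<open>H\<close>.\<close>
  also have "\<dots> \<le> (\<Sum>f\<in>verts H \<rightarrow>\<^sub>E {..<n}. \<Prod>u\<in>verts H. w (f u))"
    using w by (intro sum_mono2 finite_PiE) (auto simp: emb_def intro: prod_nonneg)
  also have "\<dots> = (\<Prod>u\<in>verts H. \<Sum>x<n. w x)"
    by (rule prod_sum_PiE[symmetric]) auto
  also have "\<dots> \<le> (real (card Q) + 1) ^ nv H"
  proof -
    have "(\<Sum>x<n. w x) = real (card ({..<n} \<inter> Q)) + (1 / real n) * real (card ({..<n} - Q))"
      by (simp add: w_def sum.If_cases Diff_eq)
    also have "\<dots> \<le> real (card Q) + 1"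
    proof (rule add_mono)
      show "real (card ({..<n} \<inter> Q)) \<le> real (card Q)" using assms(1) by (simp add: card_mono)
      have "card ({..<n} - Q) \<le> card {..<n}" by (intro card_mono) auto
      then show "(1 / real n) * real (card ({..<n} - Q)) \<le> 1" using assms(2) by (simp add: field_simps)
    qed
    finally have "(\<Sum>x<n. w x) \<le> real (card Q) + 1" .
    then show ?thesis using w by (simp add: power_mono sum_nonneg)
  qed
  finally show ?thesis .
qed

text \<open>A new edge contributes \<open>2 * \<epsilon>\<close>, the 2 because it starts active,
  and a new vertex contributes \<open>1 / n\<close>.\<close>

lemma wt_add:
  assumes "valid n T d s" "f \<in> emb n"
  shows "wt n \<epsilon> (add s f) = wt n \<epsilon> s * (2 * \<epsilon>) ^ (ne H - card (img f \<inter> cover s))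
    * (1 / real n) ^ (nv H - card (f ` verts H \<inter> \<Union>(cover s)))"
proof -
  note fin = valid_finite[OF assms(1)]
  have "card (img f \<inter> cover s) \<le> card (img f)" by (intro card_mono) auto
  then have le1: "card (img f \<inter> cover s) \<le> ne H" using card_img[OF assms(2)] by simp
  have "card (f ` verts H \<inter> \<Union>(cover s)) \<le> card (f ` verts H)" by (intro card_mono) auto
  then have le2: "card (f ` verts H \<inter> \<Union>(cover s)) \<le> nv H"
    using card_image_le[OF finite_verts, of f] by linarith
  note c = card_Union_add[OF fin(3,4) assms(2)]
  have c1: "card (\<Union>(cover s \<union> img f)) = card (\<Union>(cover s)) + (nv H - card (f ` verts H \<inter> \<Union>(cover s)))"
    using c(1) le2 by linarith
  have c2: "card (cover s \<union> img f) = card (cover s) + (ne H - card (img f \<inter> cover s))"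
    using c(2) le1 by linarith
  have "fst (add s f) = fst s \<union> (img f - cover s)" by (auto simp: add_def cover_def)
  moreover have "card (fst s \<union> (img f - cover s)) = card (fst s) + card (img f - cover s)"
    using fin by (intro card_Un_disjoint) (auto simp: cover_def)
  moreover have "card (img f - cover s) = ne H - card (img f \<inter> cover s)"
    using card_img[OF assms(2)] by (simp add: card_Diff_subset_Int)
  ultimately have c3: "card (fst (add s f)) = card (fst s) + (ne H - card (img f \<inter> cover s))" by simp
  show ?thesis unfolding wt_def cover_add c1 c2 c3 by (simp add: power_add power_mult_distrib)
qed

lemma wt_kill:
  assumes "valid n T d s" "fst s \<noteq> {}"
  shows "wt n \<epsilon> (kill s) = wt n \<epsilon> s / 2"
proof -
  have "fst (kill s) = fst s - {pick (fst s)}" by (simp add: kill_def)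
  then have "card (fst s) = Suc (card (fst (kill s)))"
    using card.remove[OF valid_finite(1)[OF assms(1)] pick_in[OF assms(2)]] by simp
  then show ?thesis using assms(2) by (simp add: wt_def)
qed

lemma finite_reg [simp]: "finite (reg n s)" and finite_deg [simp]: "finite (deg n s)"
  by (simp_all add: reg_def deg_def)

lemma finite_keep [simp]: "finite (keep n s)"
  by (simp add: keep_def)

text \<open>Chosen so that \<open>2 * small * 3 ^ nv H = 1/4\<close>, the share left to regular
  steps in \<open>sum_keep_le\<close>.\<close>

definition small :: real where "small = 1 / (8 * 3 ^ nv H)"

lemma small_pos: "small > 0"
  by (simp add: small_def)

lemma small_le: "small \<le> 1 / 8"
  using one_le_power[of "3::real" "nv H"] by (simp add: small_def field_simps)

text \<open>Subcriticality: declaring the edge dead contributes half the weight and all regular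
  copies together at most a quarter.\<close>

lemma sum_keep_le:
  assumes v: "valid n T d s" and n: "n \<ge> 1" and eps: "0 \<le> \<epsilon>" "\<epsilon> \<le> small"
  shows "sum (wt n \<epsilon>) (keep n s) \<le> 3/4 * wt n \<epsilon> s"
proof (cases "fst s = {}")
  case True
  then show ?thesis using wt_nonneg[OF eps(1)] by (simp add: keep_def)
next
  case False
  define a where "a = pick (fst s)"
  have "a \<in> cover s" using pick_in[OF False] by (simp add: a_def cover_def)
  then have ca: "card a = 2" using v by (auto simp: valid_def nsets_def)
  have fina: "finite a" using ca by (metis card.infinite zero_neq_numeral)
  have eps1: "0 \<le> 2 * \<epsilon>" "2 * \<epsilon> \<le> 1" using eps small_le by auto
  have "(\<Sum>f\<in>reg n s. wt n \<epsilon> (add s f))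
      \<le> (\<Sum>f\<in>reg n s. wt n \<epsilon> s * (2 * \<epsilon>) * (1 / real n) ^ (nv H - card (f ` verts H \<inter> a)))"
  proof (rule sum_mono)
    fix f assume "f \<in> reg n s"
    then have f: "f \<in> emb n" "img f \<inter> cover s = {a}" "f ` verts H \<inter> \<Union>(cover s) = a"
      by (auto simp: reg_def a_def)
    \<comment> \<open>Every regular step adds at least two edges; one factor
      \<open>2 * \<epsilon>\<close> suffices.\<close>
    have "(2 * \<epsilon>) ^ (ne H - 1) \<le> (2 * \<epsilon>) ^ 1"
      using eps1 ne_ge3 by (intro power_decreasing) auto
    moreover have "f ` verts H \<inter> a = a" using f(3) by auto
    moreover have "wt n \<epsilon> (add s f) = wt n \<epsilon> s * (2 * \<epsilon>) ^ (ne H - 1) * (1 / real n) ^ (nv H - card a)"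
      using wt_add[OF v f(1), of \<epsilon>] f(2,3) by simp
    ultimately show "wt n \<epsilon> (add s f) \<le> wt n \<epsilon> s * (2 * \<epsilon>) * (1 / real n) ^ (nv H - card (f ` verts H \<inter> a))"
      using wt_nonneg[OF eps(1), of n s]
      by (simp only: power_one_right) (intro mult_right_mono mult_left_mono, auto)
  qed
  also have "\<dots> = wt n \<epsilon> s * (2 * \<epsilon>) * (\<Sum>f\<in>reg n s. (1 / real n) ^ (nv H - card (f ` verts H \<inter> a)))"
    by (simp add: sum_distrib_left)
  also have "\<dots> \<le> wt n \<epsilon> s * (2 * \<epsilon>) * (\<Sum>f\<in>emb n. (1 / real n) ^ (nv H - card (f ` verts H \<inter> a)))"
    using wt_nonneg[OF eps(1)] eps by (intro mult_left_mono sum_mono2) (auto simp: reg_def)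
  also have "\<dots> \<le> wt n \<epsilon> s * (2 * \<epsilon>) * (real (card a) + 1) ^ nv H"
    using wt_nonneg[OF eps(1)] eps sum_emb_le[OF fina n] by (intro mult_left_mono) auto
  also have "\<dots> = wt n \<epsilon> s * (2 * \<epsilon> * 3 ^ nv H)" by (simp add: ca)
  also have "\<dots> \<le> wt n \<epsilon> s * (1/4)"
    using eps(2) wt_nonneg[OF eps(1)] by (intro mult_left_mono) (auto simp: small_def field_simps)
  finally have reg: "(\<Sum>f\<in>reg n s. wt n \<epsilon> (add s f)) \<le> wt n \<epsilon> s * (1/4)" .
  have "sum (wt n \<epsilon>) (keep n s) \<le> wt n \<epsilon> (kill s) + sum (wt n \<epsilon>) (add s ` reg n s)"
    using False wt_nonneg[OF eps(1)] by (simp add: keep_def sum.insert_if)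
  also have "sum (wt n \<epsilon>) (add s ` reg n s) \<le> (\<Sum>f\<in>reg n s. wt n \<epsilon> (add s f))"
    using sum_image_le[of "reg n s" "wt n \<epsilon>" "add s"] wt_nonneg[OF eps(1)] by (simp add: o_def)
  finally show ?thesis using reg wt_kill[OF v False, of \<epsilon>] by simp
qed

text \<open>New edges cost at most a factor 1, and the overlap ranges over a vertex set of size
  linear in \<open>T\<close>, hence the polynomial factor.\<close>

lemma sum_deg_le:
  assumes v: "valid n T d s" and n: "n \<ge> 1" and eps: "0 \<le> \<epsilon>" "\<epsilon> \<le> small"
  shows "sum (wt n \<epsilon>) (add s ` deg n s) \<le> real (nv H + 1) ^ nv H * real (T + 1) ^ nv H * wt n \<epsilon> s"
proof -
  have eps1: "0 \<le> 2 * \<epsilon>" "2 * \<epsilon> \<le> 1" using eps small_le by auto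
  let ?Q = "\<Union>(cover s)"
  have "sum (wt n \<epsilon>) (add s ` deg n s) \<le> (\<Sum>f\<in>deg n s. wt n \<epsilon> (add s f))"
    using sum_image_le[of "deg n s" "wt n \<epsilon>" "add s"] wt_nonneg[OF eps(1)] by (simp add: o_def)
  also have "\<dots> \<le> (\<Sum>f\<in>deg n s. wt n \<epsilon> s * (1 / real n) ^ (nv H - card (f ` verts H \<inter> ?Q)))"
  proof (rule sum_mono)
    fix f assume "f \<in> deg n s"
    then have f: "f \<in> emb n" by (simp add: deg_def)
    have "(2 * \<epsilon>) ^ (ne H - card (img f \<inter> cover s)) \<le> 1" using eps1 by (rule power_le_one)
    then have "wt n \<epsilon> s * (2 * \<epsilon>) ^ (ne H - card (img f \<inter> cover s)) \<le> wt n \<epsilon> s * 1"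
      using wt_nonneg[OF eps(1)] by (intro mult_left_mono)
    then show "wt n \<epsilon> (add s f) \<le> wt n \<epsilon> s * (1 / real n) ^ (nv H - card (f ` verts H \<inter> ?Q))"
      unfolding wt_add[OF v f] by (intro mult_right_mono) auto
  qed
  also have "\<dots> = wt n \<epsilon> s * (\<Sum>f\<in>deg n s. (1 / real n) ^ (nv H - card (f ` verts H \<inter> ?Q)))"
    by (simp add: sum_distrib_left)
  also have "\<dots> \<le> wt n \<epsilon> s * (\<Sum>f\<in>emb n. (1 / real n) ^ (nv H - card (f ` verts H \<inter> ?Q)))"
    using wt_nonneg[OF eps(1)] by (intro mult_left_mono sum_mono2) (auto simp: deg_def)
  also have "\<dots> \<le> wt n \<epsilon> s * (real (card ?Q) + 1) ^ nv H"
    using wt_nonneg[OF eps(1)] sum_emb_le[OF valid_finite(4)[OF v] n] by (intro mult_left_mono) auto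
  also have "\<dots> \<le> wt n \<epsilon> s * (real (nv H + 1) * real (T + 1)) ^ nv H"
  proof -
    have "card ?Q \<le> nv H * Suc T" using v by (simp add: valid_def)
    then have "card ?Q + 1 \<le> (nv H + 1) * (T + 1)" by simp
    then have "real (card ?Q) + 1 \<le> real (nv H + 1) * real (T + 1)"
      by (metis of_nat_1 of_nat_add of_nat_le_iff of_nat_mult)
    then show ?thesis using wt_nonneg[OF eps(1)] by (intro mult_left_mono power_mono) auto
  qed
  finally show ?thesis by (simp add: power_mult_distrib mult_ac)
qed

text \<open>A supersolution of the recursion in \<open>T\<close> and \<open>d\<close>. A degenerate
  step brings a polynomial of degree \<open>nv H\<close>; the extra degree pays for the choice of
  its time, and 4/3 for the contraction it lacks.\<close>

definition rate :: "nat \<Rightarrow> nat \<Rightarrow> real" where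
  "rate T d = (4/3 * real (nv H + 1) ^ nv H) ^ d * real (T + 1) ^ ((nv H + 1) * d) * (3/4) ^ T"

lemma rate_step: "3/4 * rate T (Suc d) + real (nv H + 1) ^ nv H * real (T + 1) ^ nv H * rate T d
  \<le> rate (Suc T) (Suc d)"
proof -
  define K where "K = real (nv H + 1) ^ nv H"
  define m where "m = nv H + (nv H + 1) * d"
  have m: "(nv H + 1) * Suc d = Suc m" by (simp add: m_def)
  have c: "(4/3 * K) ^ Suc d * (3/4) ^ Suc T \<ge> 0" by (simp add: K_def)
  \<comment> \<open>After cancelling common factors, the claim is this inequality between powers of
    \<open>T + 1\<close> and \<open>T + 2\<close>.\<close>
  have "real (T + 1) ^ Suc m + real (T + 1) ^ m = real (T + 1) ^ m * real (T + 2)"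
    by (simp add: algebra_simps)
  also have "\<dots> \<le> real (T + 2) ^ m * real (T + 2)" by (intro mult_right_mono power_mono) auto
  also have "\<dots> = real (T + 2) ^ Suc m" by simp
  finally have "real (T + 1) ^ Suc m + real (T + 1) ^ m \<le> real (T + 2) ^ Suc m" .
  from mult_left_mono[OF this c]
  show ?thesis unfolding rate_def K_def[symmetric] m
    by (simp add: m_def power_add algebra_simps)
qed

lemma sum_reach_le:
  assumes n: "n \<ge> 1" and eps: "0 \<le> \<epsilon>" "\<epsilon> \<le> small"
  shows "sum (wt n \<epsilon>) (reach n T d) \<le> 2 * \<epsilon> * rate T d"
proof (induction T arbitrary: d)
  case 0
  show ?case
  proof (cases d)
    case 0
    have "sum (wt n \<epsilon>) (reach n 0 0) \<le> (\<Sum>f\<in>emb n. wt n \<epsilon> (img f, {}))"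
      using sum_image_le[of "emb n" "wt n \<epsilon>" "\<lambda>f. (img f, {})"] wt_nonneg[OF eps(1)]
      by (simp add: o_def)
    also have "\<dots> = (\<Sum>f\<in>emb n. (2 * \<epsilon>) ^ ne H * (1 / real n) ^ nv H)"
      using embD(1) by (intro sum.cong refl)
        (simp add: wt_def cover_def card_img Union_img card_image power_mult_distrib)
    also have "\<dots> = (2 * \<epsilon>) ^ ne H * (\<Sum>f\<in>emb n. (1 / real n) ^ (nv H - card (f ` verts H \<inter> {})))"
      by simp
    also have "\<dots> \<le> (2 * \<epsilon>) ^ ne H * (real (card ({} :: nat set)) + 1) ^ nv H"
      using sum_emb_le[of "{}" n] n eps by (intro mult_left_mono) auto
    \<comment> \<open>One factor \<open>\<epsilon>\<close> is retained: it is what tends to 0 in the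
      second part of the theorem.\<close>
    also have "\<dots> \<le> (2 * \<epsilon>) ^ 1"
      using power_decreasing[of 1 "ne H" "2 * \<epsilon>"] ne_ge3 eps small_le by simp
    finally show ?thesis using 0 by (simp add: rate_def)
  qed (use eps in \<open>simp add: rate_def\<close>)
next
  case (Suc T)
  have keep: "sum (wt n \<epsilon>) (\<Union>s\<in>reach n T d. keep n s) \<le> 2 * \<epsilon> * (3/4 * rate T d)" for d
  proof -
    have "sum (wt n \<epsilon>) (\<Union>s\<in>reach n T d. keep n s) \<le> (\<Sum>s\<in>reach n T d. sum (wt n \<epsilon>) (keep n s))"
      using wt_nonneg[OF eps(1)] by (intro sum_UN_le) auto
    also have "\<dots> \<le> (\<Sum>s\<in>reach n T d. 3/4 * wt n \<epsilon> s)"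
      by (intro sum_mono sum_keep_le[OF reach_valid n eps])
    also have "\<dots> = 3/4 * sum (wt n \<epsilon>) (reach n T d)" by (simp add: sum_distrib_left)
    finally show ?thesis using Suc[of d] by linarith
  qed
  show ?case
  proof (cases d)
    case 0
    then show ?thesis using keep[of 0] by (simp add: rate_def)
  next
    case (Suc d')
    define c where "c = real (nv H + 1) ^ nv H * real (T + 1) ^ nv H"
    have c: "c \<ge> 0" by (simp add: c_def)
    have "sum (wt n \<epsilon>) (\<Union>s\<in>reach n T d'. add s ` deg n s)
        \<le> (\<Sum>s\<in>reach n T d'. sum (wt n \<epsilon>) (add s ` deg n s))"
      using wt_nonneg[OF eps(1)] by (intro sum_UN_le) auto
    also have "\<dots> \<le> (\<Sum>s\<in>reach n T d'. c * wt n \<epsilon> s)"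
      unfolding c_def by (intro sum_mono sum_deg_le[OF reach_valid n eps])
    also have "\<dots> = c * sum (wt n \<epsilon>) (reach n T d')" by (simp add: sum_distrib_left)
    also have "\<dots> \<le> c * (2 * \<epsilon> * rate T d')" by (rule mult_left_mono[OF Suc.IH c])
    finally have deg: "sum (wt n \<epsilon>) (\<Union>s\<in>reach n T d'. add s ` deg n s) \<le> 2 * \<epsilon> * (c * rate T d')"
      by (simp add: mult_ac)
    have "sum (wt n \<epsilon>) (reach n (Suc T) d) \<le>
        sum (wt n \<epsilon>) (\<Union>s\<in>reach n T d. keep n s) + sum (wt n \<epsilon>) (\<Union>s\<in>reach n T d'. add s ` deg n s)"
      using wt_nonneg[OF eps(1)] by (simp add: Suc sum_Un sum_nonneg)
    also have "\<dots> \<le> 2 * \<epsilon> * (3/4 * rate T d + c * rate T d')"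
      using keep[of d] deg by (simp add: distrib_left)
    also have "\<dots> \<le> 2 * \<epsilon> * rate (Suc T) d"
      using rate_step[of T d'] eps unfolding c_def Suc by (intro mult_left_mono) auto
    finally show ?thesis .
  qed
qed

definition total :: real where "total = (\<Sum>T. \<Sum>d\<le>max_deg. rate T d)"

text \<open>The bound is uniform in \<open>N\<close>, which will grow with \<open>n\<close>.\<close>

lemma sum_all_le:
  assumes n: "n \<ge> 1" and eps: "0 \<le> \<epsilon>" "\<epsilon> \<le> small"
  shows "(\<Sum>T\<le>N. \<Sum>d\<le>max_deg. sum (wt n \<epsilon>) (reach n T d)) \<le> 2 * \<epsilon> * total"
proof -
  have "summable (\<lambda>T. rate T d)" for d
    unfolding rate_def mult.assoc by (intro summable_mult summable_poly_geometric)
  then have sm: "summable (\<lambda>T. \<Sum>d\<le>max_deg. rate T d)" by (intro summable_sum)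
  have "rate T d \<ge> 0" for T d by (simp add: rate_def)
  then have le: "(\<Sum>T\<le>N. \<Sum>d\<le>max_deg. rate T d) \<le> total"
    unfolding total_def by (intro sum_le_suminf[OF sm]) (auto intro: sum_nonneg)
  have "(\<Sum>T\<le>N. \<Sum>d\<le>max_deg. sum (wt n \<epsilon>) (reach n T d)) \<le> (\<Sum>T\<le>N. \<Sum>d\<le>max_deg. 2 * \<epsilon> * rate T d)"
    by (intro sum_mono sum_reach_le[OF n eps])
  also have "\<dots> = 2 * \<epsilon> * (\<Sum>T\<le>N. \<Sum>d\<le>max_deg. rate T d)" by (simp add: sum_distrib_left)
  also have "\<dots> \<le> 2 * \<epsilon> * total" using le eps by (intro mult_left_mono) auto
  finally show ?thesis .
qed

section \<open>The first moment bound\<close>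

text \<open>Dividing the bound on the potential by \<open>ne H - 1\<close> bounds the exponent of
  \<open>n\<close> hidden in \<open>wt\<close>; a potential of at most \<open>- j\<close> gains a
  further power of \<open>n\<close>.\<close>

lemma power_le_wt:
  assumes "n \<ge> 1" "p \<ge> 0" and pot: "pot (cover s) \<le> - int j"
  shows "p ^ card (cover s)
    \<le> wt n (p * real n powr (1 / m2 H)) s * real n powr (- real j / (real (ne H) - 1))"
proof -
  define e where "e = card (cover s)"
  define v where "v = card (\<Union>(cover s))"
  have n: "real n > 0" "real n \<ge> 1" using assms(1) by auto
  have pos: "real (ne H) - 1 > 0" using ne_ge3 by simp
  have m: "1 / m2 H = (real (nv H) - 2) / (real (ne H) - 1)" by (simp add: m2_eq)
  have "real_of_int (pot (cover s)) \<le> real_of_int (- int j)"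
    using pot by (simp only: of_int_le_iff)
  then have "(real (ne H) - 1) * real v - (real (nv H) - 2) * real e \<le> - real j"
    unfolding pot_def e_def v_def by simp
  then have "0 \<le> ((real (nv H) - 2) * real e - (real (ne H) - 1) * real v - real j) / (real (ne H) - 1)"
    using pos by (intro divide_nonneg_pos) auto
  also have "\<dots> = 1 / m2 H * real e - real v - real j / (real (ne H) - 1)"
  proof -
    have "(a * x - d * y - z) / d = a / d * x - y - z / d" if "d > 0" for a d x y z :: real
      using that by (simp add: field_simps)
    then show ?thesis unfolding m using pos by blast
  qed
  finally have "1 \<le> real n powr (1 / m2 H * real e - real v - real j / (real (ne H) - 1))"
    using n by (simp add: ge_one_powr_ge_zero)
  also have "\<dots> = (real n powr (1 / m2 H)) ^ e * (1 / real n) ^ v * real n powr (- real j / (real (ne H) - 1))"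
  proof -
    have "real n powr (1 / m2 H * real e) = (real n powr (1 / m2 H)) ^ e"
      using n by (subst powr_powr[symmetric]) (simp add: powr_realpow)
    then show ?thesis
      using n by (simp add: powr_diff powr_minus_divide powr_realpow power_one_over)
  qed
  finally have "p ^ e * 1 \<le> p ^ e * ((real n powr (1 / m2 H)) ^ e * (1 / real n) ^ v
      * real n powr (- real j / (real (ne H) - 1)))"
    using assms(2) by (intro mult_left_mono) auto
  also have "\<dots> = ((p * real n powr (1 / m2 H)) ^ e * (1 / real n) ^ v * 1)
      * real n powr (- real j / (real (ne H) - 1))"
    by (simp add: power_mult_distrib)
  \<comment> \<open>The activity factor \<open>2 ^ card (fst s)\<close> is at least 1.\<close>
  also have "\<dots> \<le> wt n (p * real n powr (1 / m2 H)) s * real n powr (- real j / (real (ne H) - 1))"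
    unfolding wt_def e_def v_def using assms(2) by (intro mult_right_mono mult_left_mono) auto
  finally show ?thesis by (simp add: e_def)
qed

text \<open>Union bound over all reachable covers of potential at most \<open>- j\<close>; the
  second part of the theorem takes \<open>j = 0\<close>, the first \<open>j = 1\<close>.\<close>

lemma prob_ramsey_le:
  assumes n: "n \<ge> 1" and p: "0 \<le> p" "p \<le> 1" and eps: "p * real n powr (1 / m2 H) \<le> small"
    and k: "k \<ge> 2" and j: "j \<le> 1"
    and dens: "\<And>E. E \<subseteq> nsets {..<n} 2 \<Longrightarrow> ramsey n k E \<Longrightarrow>
      (\<And>S. S \<subseteq> E \<Longrightarrow> S \<noteq> {} \<Longrightarrow> closed_in n E S \<Longrightarrow> S = E) \<Longrightarrow> pot E \<le> - int j"
  shows "measure_pmf.prob (random_graph n p) {G. constrained_ramsey G (star k) H}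
    \<le> 2 * (p * real n powr (1 / m2 H)) * total * real n powr (- real j / (real (ne H) - 1))"
proof -
  define \<epsilon> where "\<epsilon> = p * real n powr (1 / m2 H)"
  define q where "q = real n powr (- real j / (real (ne H) - 1))"
  define N where "N = 2 * card (nsets {..<n} 2)"
  define I where "I = (SIGMA T:{..N}. SIGMA d:{..max_deg}. {s \<in> reach n T d. pot (cover s) \<le> - int j})"
  let ?M = "random_graph n p"
  let ?A = "\<lambda>(T :: nat, d :: nat, s). {G :: nat sgraph. cover s \<subseteq> edges G}"
  have eps0: "\<epsilon> \<ge> 0" using p by (simp add: \<epsilon>_def)
  have finI: "finite I" unfolding I_def by (intro finite_SigmaI) auto
  have "measure_pmf.prob ?M {G. constrained_ramsey G (star k) H} \<le> measure_pmf.prob ?M (\<Union>i\<in>I. ?A i)"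
  proof (rule measure_pmf.finite_measure_mono_AE)
    show "AE G in measure_pmf ?M. G \<in> {G. constrained_ramsey G (star k) H} \<longrightarrow> G \<in> (\<Union>i\<in>I. ?A i)"
      unfolding AE_measure_pmf_iff
    proof (intro ballI impI)
      fix G assume G: "G \<in> set_pmf ?M" "G \<in> {G. constrained_ramsey G (star k) H}"
      note supp = random_graph_support[OF G(1)]
      have r: "ramsey n k (edges G)" unfolding ramsey_def using G(2) supp(1)[symmetric] by simp
      have Q: "pot S \<le> - int j" if "pot S < 0" for S using that j by simp
      obtain T d s where "T \<le> N" "d \<le> max_deg" "s \<in> reach n T d" "cover s \<subseteq> edges G"
        "pot (cover s) \<le> - int j"
        using ramsey_witness[OF r supp(2) k, of "\<lambda>S. pot S \<le> - int j"] Q dens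
        unfolding N_def by blast
      then have "(T, d, s) \<in> I" "G \<in> ?A (T, d, s)" by (auto simp: I_def)
      then show "G \<in> (\<Union>i\<in>I. ?A i)" by blast
    qed
  qed auto
  also have "\<dots> \<le> (\<Sum>i\<in>I. measure_pmf.prob ?M (?A i))"
    by (rule measure_pmf.finite_measure_subadditive_finite[OF finI]) auto
  also have "\<dots> \<le> (\<Sum>(T, d, s)\<in>I. wt n \<epsilon> s * q)"
  proof (rule sum_mono, clarify)
    fix T d s assume "(T, d, s) \<in> I"
    then have s: "s \<in> reach n T d" "pot (cover s) \<le> - int j" by (auto simp: I_def)
    have "cover s \<subseteq> nsets {..<n} 2" using reach_valid[OF s(1)] by (simp add: valid_def)
    then show "measure_pmf.prob ?M {G. cover s \<subseteq> edges G} \<le> wt n \<epsilon> s * q"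
      using power_le_wt[OF n p(1) s(2)] by (simp add: prob_superset_edges p \<epsilon>_def q_def)
  qed
  also have "\<dots> = (\<Sum>T\<le>N. \<Sum>d\<le>max_deg. \<Sum>s | s \<in> reach n T d \<and> pot (cover s) \<le> - int j. wt n \<epsilon> s * q)"
    unfolding I_def by (simp add: sum.Sigma)
  also have "\<dots> \<le> (\<Sum>T\<le>N. \<Sum>d\<le>max_deg. \<Sum>s\<in>reach n T d. wt n \<epsilon> s * q)"
    using wt_nonneg[OF eps0] by (intro sum_mono sum_mono2) (auto simp: q_def)
  also have "\<dots> = (\<Sum>T\<le>N. \<Sum>d\<le>max_deg. sum (wt n \<epsilon>) (reach n T d)) * q"
    by (simp add: sum_distrib_right)
  also have "\<dots> \<le> 2 * \<epsilon> * total * q"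
    using eps sum_all_le[OF n eps0] by (intro mult_right_mono) (auto simp: \<epsilon>_def q_def)
  finally show ?thesis by (simp add: \<epsilon>_def q_def)
qed

section \<open>The two thresholds\<close>

lemma threshold_le:
  assumes k: "k \<ge> 2"
    and hyp: "\<And>G :: nat sgraph. simple_graph G \<Longrightarrow> max_density G \<le> m2 H \<Longrightarrow>
      \<not> constrained_ramsey G (star k) H"
    and p: "\<And>n. 0 \<le> p n \<and> p n \<le> 1" "\<And>n. n \<ge> 1 \<Longrightarrow> p n \<le> small * real n powr (- 1 / m2 H)"
  shows "(\<lambda>n. measure_pmf.prob (random_graph n (p n)) {G. constrained_ramsey G (star k) H})
    \<longlonglongrightarrow> 0"
proof (rule tendsto_sandwich[where f = "\<lambda>_. 0"])
  have pos: "real (ne H) - 1 > 0" using ne_ge3 by simp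
  define \<delta> where "\<delta> = 1 / (real (ne H) - 1)"
  have \<delta>: "\<delta> > 0" using pos by (simp add: \<delta>_def)
  \<comment> \<open>In \<open>sum_all_le\<close> at \<open>\<epsilon> = small\<close> the left side
    is a sum of nonnegative weights.\<close>
  have tot: "total \<ge> 0" using sum_all_le[of 1 small 0] small_pos wt_nonneg
    by (smt (verit, best) le_numeral_extra(4) mult_pos_neg sum_nonneg)
  show "\<forall>\<^sub>F n in sequentially. measure_pmf.prob (random_graph n (p n)) {G. constrained_ramsey G (star k) H}
      \<le> 2 * small * total * real n powr (- \<delta>)"
    using eventually_ge_at_top[of 1]
  proof eventually_elim
    case (elim n)
    have "p n * real n powr (1 / m2 H) \<le> small * real n powr (- 1 / m2 H) * real n powr (1 / m2 H)"
      by (rule mult_right_mono[OF p(2)[OF elim]]) simp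
    also have "\<dots> = small" using elim by (simp add: mult.assoc powr_add[symmetric])
    finally have eps: "p n * real n powr (1 / m2 H) \<le> small" .
    have "pot E \<le> - int 1" if E: "E \<subseteq> nsets {..<n} 2" "ramsey n k E"
      and conn: "\<And>S. S \<subseteq> E \<Longrightarrow> S \<noteq> {} \<Longrightarrow> closed_in n E S \<Longrightarrow> S = E" for E
    proof -
      \<comment> \<open>The hypothesis excludes density at most \<open>m2 H\<close>, so the integer
        potential is at most -1, which gains \<open>n powr (- \<delta>)\<close>.\<close>
      have "max_density (nat_graph n E) > m2 H"
        using hyp[OF simple_nat_graph[OF E(1)]] E(2) by (force simp: ramsey_def)
      then show ?thesis using dense_subgraph_pot(2)[OF elim E(1) conn] by simp
    qed
    then have "measure_pmf.prob (random_graph n (p n)) {G. constrained_ramsey G (star k) H}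
        \<le> 2 * (p n * real n powr (1 / m2 H)) * total * real n powr (- real 1 / (real (ne H) - 1))"
      using p(1) by (intro prob_ramsey_le[OF elim _ _ eps k]) auto
    also have "\<dots> \<le> 2 * small * total * real n powr (- real 1 / (real (ne H) - 1))"
      using eps tot by (intro mult_right_mono mult_left_mono) auto
    finally show ?case by (simp add: \<delta>_def)
  qed
  have "(\<lambda>n. real n powr (- \<delta>)) \<longlonglongrightarrow> 0" using \<delta> by real_asymp
  then show "(\<lambda>n. 2 * small * total * real n powr (- \<delta>)) \<longlonglongrightarrow> 0"
    by (rule tendsto_mult_right_zero)
qed (auto intro: always_eventually)

lemma threshold_less:
  assumes k: "k \<ge> 2"
    and hyp: "\<And>G :: nat sgraph. simple_graph G \<Longrightarrow> max_density G < m2 H \<Longrightarrow>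
      \<not> constrained_ramsey G (star k) H"
    and p: "\<And>n. 0 \<le> p n \<and> p n \<le> 1" "p \<in> o(\<lambda>n. real n powr (- 1 / m2 H))"
  shows "(\<lambda>n. measure_pmf.prob (random_graph n (p n)) {G. constrained_ramsey G (star k) H})
    \<longlonglongrightarrow> 0"
proof (rule tendsto_sandwich[where f = "\<lambda>_. 0"])
  have "(\<lambda>n. p n / real n powr (- 1 / m2 H)) \<longlonglongrightarrow> 0" using p(2) by (rule smalloD_tendsto)
  then have lim: "(\<lambda>n. p n * real n powr (1 / m2 H)) \<longlonglongrightarrow> 0"
    by (simp add: powr_minus divide_inverse)
  have "\<forall>\<^sub>F n in sequentially. p n * real n powr (1 / m2 H) < small"
    using order_tendstoD(2)[OF lim small_pos] .
  then show "\<forall>\<^sub>F n in sequentially. measure_pmf.prob (random_graph n (p n)) {G. constrained_ramsey G (star k) H}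
      \<le> 2 * total * (p n * real n powr (1 / m2 H))"
    using eventually_ge_at_top[of 1]
  proof eventually_elim
    case (elim n)
    have "pot E \<le> - int 0" if E: "E \<subseteq> nsets {..<n} 2" "ramsey n k E"
      and conn: "\<And>S. S \<subseteq> E \<Longrightarrow> S \<noteq> {} \<Longrightarrow> closed_in n E S \<Longrightarrow> S = E" for E
    proof -
      \<comment> \<open>Density equal to \<open>m2 H\<close> is possible here, so the potential is
        only nonpositive and no power of \<open>n\<close> is gained; convergence comes from
        \<open>lim\<close>.\<close>
      have "max_density (nat_graph n E) \<ge> m2 H"
        using hyp[OF simple_nat_graph[OF E(1)]] E(2) by (force simp: ramsey_def)
      then show ?thesis using dense_subgraph_pot(1)[OF elim(2) E(1) conn] by simp
    qed
    then have "measure_pmf.prob (random_graph n (p n)) {G. constrained_ramsey G (star k) H}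
        \<le> 2 * (p n * real n powr (1 / m2 H)) * total * real n powr (- real 0 / (real (ne H) - 1))"
      using p(1) elim by (intro prob_ramsey_le[OF elim(2) _ _ _ k]) auto
    then show ?case using elim(2) by (simp add: mult_ac)
  qed
  show "(\<lambda>n. 2 * total * (p n * real n powr (1 / m2 H))) \<longlonglongrightarrow> 0"
    using lim by (rule tendsto_mult_right_zero)
qed (auto intro: always_eventually)

end

theorem theorem4p1:
  fixes H :: "'v sgraph" and k :: nat
  assumes "simple_graph H" and "strictly_2_balanced H" and "m2 H > 1" and "k \<ge> 3"
  shows
    "((\<forall>G :: nat sgraph. simple_graph G \<and> max_density G \<le> m2 H
          \<longrightarrow> \<not> constrained_ramsey G (star k) H) \<longrightarrow>
      (\<exists>c::real. c > 0 \<and>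
        (\<forall>p :: nat \<Rightarrow> real.
          (\<forall>n. 0 \<le> p n \<and> p n \<le> 1) \<and>
          (\<forall>n\<ge>1. p n \<le> c * real n powr (- 1 / m2 H)) \<longrightarrow>
          (\<lambda>n. measure_pmf.prob (random_graph n (p n)) {G. constrained_ramsey G (star k) H})
            \<longlonglongrightarrow> 0)))
     \<and>
     ((\<forall>G :: nat sgraph. simple_graph G \<and> max_density G < m2 H
          \<longrightarrow> \<not> constrained_ramsey G (star k) H) \<longrightarrow>
      (\<forall>p :: nat \<Rightarrow> real.
          (\<forall>n. 0 \<le> p n \<and> p n \<le> 1) \<and>
          p \<in> o(\<lambda>n. real n powr (- 1 / m2 H)) \<longrightarrow>
          (\<lambda>n. measure_pmf.prob (random_graph n (p n)) {G. constrained_ramsey G (star k) H})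
            \<longlonglongrightarrow> 0))"
proof -
  interpret balanced_graph H using assms(1-3) by unfold_locales
  have k: "k \<ge> 2" using assms(4) by simp
  show ?thesis
    \<comment> \<open>The constant \<open>c\<close> is \<open>small\<close>, which depends only on
      \<open>nv H\<close>.\<close>
    by (intro conjI impI allI exI[of _ small] small_pos threshold_le[OF k] threshold_less[OF k]) blast+
qed

end
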